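(* Let $n\geq 5$ be an integer. For a nonperiodic binary word $w$ of length $|w|=2^n$, let $A(w)$ be its Arnold complexity and let $\min_{w\to v}A(w)$ be the minimal number of operators $F(\cdot,h)$ (with ranks $h=2^{r}$, $0\le r\le n$) required to transform the infinite periodic word $(w)$ into some final word $(v)$. Let $Sh(n)=\max_{w}\min_{w\to v}A(w)$ denote the Shannon function, the maximum being taken over the nonperiodic binary words $w$ of length $2^n$ whose complexity $A(w)$ has the parity under consideration. Then $$ Sh(n)\leq \begin{cases} \lfloor n-2\sqrt{n}+1\rfloor & \text{when } A(w) \text{ is odd},\\ \lfloor n-2\sqrt{n}+2\rfloor & \text{otherwise.} \end{cases} $$ That is, for every nonperiodic binary word $w$ with $|w|=2^n$, the minimal number of operators transforming $(w)$ into a final word is at most $\lfloor n-2\sqrt{n}+1\rfloor$ if $A(w)$ is odd, and at most $\lfloor n-2\sqrt{n}+2\rfloor$ if $A(w)$ is even.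
   Context: A binary word $w=x_1x_2\ldots x_{2^n}$, $x_i\in\{0,1\}$, is nonperiodic if $w\neq u^k$ for every word $u$ and every $k\geq 2$. $(w)=ww\ldots$ denotes the infinite periodic word obtained by repeating $w$; $(0)$ is the all-zero infinite word. Operators: for $h=2^{r}$ with $0\le r\le n$ (called the rank of the operator), $F(\cdot,h)$ maps an infinite word $y_1y_2\ldots$ to the infinite word $z_1z_2\ldots$ with $z_j=y_j\oplus y_{j+h}$ for all $j\ge 1$, where $\oplus$ is addition modulo 2. Complexity: for an infinite word $(u)$ whose period is a power of 2, the (Arnold) complexity $A(u)$ is the number of applications of the rank-1 operator $F(\cdot,1)$ needed to reach $(0)$ for the first time starting from $(u)$ (equivalently, $A(u)=s-1$ where $(u)=(u_1),(u_2),\ldots,(u_s)=(0)$ is the chain of distinct words with $(u_{i+1})=F(u_i,1)$). The complexity of a finite word $w$ is that of $(w)$. Final words: an infinite periodic word $(v)$ (of period a power of 2) is called final if, for some integer $k\geq 1$, $A(v)$ equals one of the numbers $2^{k}-2^{m}+1$ with $1\leq m\leq k-1$, or $2^{k}-2^{k-1}$. Transformation: $(w)$ is transformed into $(v)$ by $t\ge 0$ operators if there are ranks $h_1,\ldots,h_t$, each of the form $2^{r}$ with $0\le r\le n$, such that successively applying $F(\cdot,h_1),\ldots,F(\cdot,h_t)$ to $(w)$ yields $(v)$. (If $(w)$ is itself final, the minimal number of operators is $0$.) *)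

theory Defs
  imports Complex_Main "HOL-Library.Z2"
begin

text \<open>Binary words are lists over the two-element field \<open>bit\<close>, whose addition is addition modulo 2.
  Infinite words are indexed from 0 instead of 1.\<close>

definition nonperiodic :: "bit list \<Rightarrow> bool" where
  "nonperiodic w \<longleftrightarrow> \<not> (\<exists>u k. k \<ge> 2 \<and> w = concat (replicate k u))"

text \<open>The infinite word \<open>(w) = www\<dots>\<close>; only meaningful for nonempty \<open>w\<close>.\<close>

definition inf_word :: "bit list \<Rightarrow> nat \<Rightarrow> bit" where
  "inf_word w j = w ! (j mod length w)"

definition zero_word :: "nat \<Rightarrow> bit" where
  "zero_word = (\<lambda>_. 0)"

definition shift_add :: "nat \<Rightarrow> (nat \<Rightarrow> bit) \<Rightarrow> nat \<Rightarrow> bit" where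
  "shift_add h y j = y j + y (j + h)"

text \<open>By \<open>arnold_reaches_zero\<close> below, the zero word is always reached if the period is a power of 2.\<close>

definition arnold :: "(nat \<Rightarrow> bit) \<Rightarrow> nat" where
  "arnold y = (LEAST s. (shift_add 1 ^^ s) y = zero_word)"

definition final_word :: "(nat \<Rightarrow> bit) \<Rightarrow> bool" where
  "final_word y \<longleftrightarrow>
     (\<exists>v r. length v = 2 ^ r \<and> y = inf_word v) \<and>
     (\<exists>k\<ge>1. (\<exists>m. 1 \<le> m \<and> m \<le> k - 1 \<and> arnold y = 2 ^ k - 2 ^ m + 1)
           \<or> arnold y = 2 ^ k - 2 ^ (k - 1))"

text \<open>The list \<open>rs\<close> contains the exponents of the ranks, in the order of application.\<close>

definition transforms_by :: "nat \<Rightarrow> nat \<Rightarrow> (nat \<Rightarrow> bit) \<Rightarrow> (nat \<Rightarrow> bit) \<Rightarrow> bool" where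
  "transforms_by n t y z \<longleftrightarrow>
     (\<exists>rs. length rs = t \<and> (\<forall>r\<in>set rs. r \<le> n) \<and> fold (\<lambda>r. shift_add (2 ^ r)) rs y = z)"

definition min_ops :: "nat \<Rightarrow> bit list \<Rightarrow> nat" where
  "min_ops n w = (LEAST t. \<exists>v. final_word v \<and> transforms_by n t (inf_word w) v)"

text \<open>The Shannon function over the words whose complexity satisfies \<open>P\<close> (\<open>odd\<close> or \<open>even\<close>).\<close>

definition Sh :: "(nat \<Rightarrow> bool) \<Rightarrow> nat \<Rightarrow> nat" where
  "Sh P n = Max {min_ops n w | w. length w = 2 ^ n \<and> nonperiodic w \<and> P (arnold (inf_word w))}"

lemma shift_add_power: "shift_add 1 ^^ (2 ^ r) = shift_add (2 ^ r)"
proof (induction r)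
  case 0
  show ?case by simp
next
  case (Suc r)
  have "(shift_add 1 ^^ (2 ^ Suc r)) = (shift_add 1 ^^ (2 ^ r)) \<circ> (shift_add 1 ^^ (2 ^ r))"
    by (simp add: funpow_add [symmetric] mult_2)
  also have "\<dots> = shift_add (2 ^ r) \<circ> shift_add (2 ^ r)"
    using Suc.IH by simp
  also have "\<dots> = shift_add (2 ^ Suc r)"
  proof (intro ext)
    fix y :: "nat \<Rightarrow> bit" and j :: nat
    have "y (j + 2 ^ r) + y (j + 2 ^ r) = 0"
      by (cases "y (j + 2 ^ r)") simp_all
    then show "(shift_add (2 ^ r) \<circ> shift_add (2 ^ r)) y j = shift_add (2 ^ Suc r) y j"
      by (cases "y j"; cases "y (j + 2 ^ r)") (simp_all add: shift_add_def mult_2 add.assoc)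
  qed
  finally show ?case .
qed

lemma arnold_reaches_zero:
  assumes "length w = 2 ^ r"
  shows "(shift_add 1 ^^ arnold (inf_word w)) (inf_word w) = zero_word"
  unfolding arnold_def
proof (rule LeastI)
  have "x + x = 0" for x :: bit
    by (cases x) simp_all
  then show "(shift_add 1 ^^ (2 ^ r)) (inf_word w) = zero_word"
    unfolding shift_add_power
    by (intro ext) (simp add: shift_add_def inf_word_def zero_word_def assms)
qed

end

theory Submission
  imports Defs "HOL-Library.FuncSet" "HOL-Library.Nat_Bijection"
    "HOL-Computational_Algebra.Primes"
begin

text \<open>The operator of rank \<open>2 ^ r\<close> is the \<open>2 ^ r\<close>-th power of the operator of rank 1, so it lowers
  the complexity \<open>a\<close> by \<open>2 ^ r\<close>. For odd \<open>a\<close>, reaching the final complexity \<open>2 ^ k - 2 ^ m + 1\<close>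
  takes one operator for each binary one of \<open>a - 1\<close> outside the run of ones \<open>{m..<k}\<close>. If \<open>a - 1\<close>
  has \<open>z\<close> zeros among its \<open>n\<close> digits, then its \<open>n - z\<close> ones form at most \<open>z\<close> runs, because the
  lowest digit is 0. So some run has at least \<open>(n - z) / z\<close> ones, and at most
  \<open>n + 1 - (z + n / z) \<le> n + 1 - 2 * sqrt n\<close> operators remain. For even \<open>a\<close>, one operator of
  rank 1 is applied first.\<close>

section \<open>Complexity under powers of the rank-1 operator\<close>

lemma shift_add_one_zero_word [simp]: "(shift_add 1 ^^ s) zero_word = zero_word"
proof (induction s)
  case 0
  show ?case by simp
next
  case (Suc s)
  then show ?case by (simp add: shift_add_def zero_word_def fun_eq_iff del: One_nat_def)
qed

text \<open>The zero word is a fixed point, so once reached it persists. The hypothesis ensures that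
  the \<open>LEAST\<close> in \<open>arnold\<close> is attained. Bounds on the complexity thus
  become equations between words.\<close>

lemma arnold_le_iff:
  assumes "(shift_add 1 ^^ N) y = zero_word"
  shows "arnold y \<le> s \<longleftrightarrow> (shift_add 1 ^^ s) y = zero_word"
proof
  have zero: "(shift_add 1 ^^ arnold y) y = zero_word"
    unfolding arnold_def using assms by (rule LeastI)
  assume "arnold y \<le> s"
  then have "(shift_add 1 ^^ s) y = (shift_add 1 ^^ (s - arnold y)) ((shift_add 1 ^^ arnold y) y)"
    by (simp add: funpow_add [THEN fun_cong, simplified comp_apply, symmetric] del: One_nat_def)
  then show "(shift_add 1 ^^ s) y = zero_word"
    by (simp only: zero shift_add_one_zero_word)
next
  assume "(shift_add 1 ^^ s) y = zero_word"
  then show "arnold y \<le> s"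
    unfolding arnold_def by (rule Least_le)
qed

text \<open>Truncated subtraction is intended: once the zero word is reached, the complexity stays
  0.\<close>

lemma arnold_funpow:
  assumes "(shift_add 1 ^^ N) y = zero_word"
  shows "arnold ((shift_add 1 ^^ s) y) = arnold y - s"
proof -
  have comm: "(shift_add 1 ^^ t) ((shift_add 1 ^^ s) y) = (shift_add 1 ^^ (t + s)) y" for t
    by (simp add: funpow_add del: One_nat_def)
  have "arnold y \<le> N + s"
    using arnold_le_iff [OF assms, of N] assms by simp
  then have zero: "(shift_add 1 ^^ N) ((shift_add 1 ^^ s) y) = zero_word"
    unfolding comm by (simp only: arnold_le_iff [OF assms])
  have "arnold ((shift_add 1 ^^ s) y) \<le> t \<longleftrightarrow> arnold y \<le> t + s" for t
    by (simp only: arnold_le_iff [OF zero] arnold_le_iff [OF assms] comm)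
  \<comment> \<open>The two instances of \<open>t\<close> give one inequality each.\<close>
  from this [of "arnold y - s"] this [of "arnold ((shift_add 1 ^^ s) y)"]
  show ?thesis by (simp del: One_nat_def) linarith
qed

section \<open>Periods that are powers of 2, and nonperiodicity\<close>

lemma bit_add_eq_0_iff: "x + y = 0 \<longleftrightarrow> x = y" for x y :: bit
  by (cases x; cases y) simp_all

lemma period_iff:
  "(shift_add 1 ^^ (2 ^ r)) y = zero_word \<longleftrightarrow> (\<forall>j. y (j + 2 ^ r) = y j)"
  unfolding shift_add_power by (simp only: shift_add_def zero_word_def fun_eq_iff bit_add_eq_0_iff) metis

lemma periodic_mod:
  fixes y :: "nat \<Rightarrow> 'a"
  assumes "\<forall>j. y (j + p) = y j"
  shows "y (j mod p) = y j"
proof -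
  have "y (i + k * p) = y i" for i k
  proof (induction k)
    case (Suc k)
    then show ?case using assms [rule_format, of "i + k * p"] by (simp add: ac_simps)
  qed simp
  from this [of "j mod p" "j div p"] show ?thesis by simp
qed

text \<open>The first \<open>2 ^ r\<close> letters repeat. This provides the finite word for the
  binomial words and for the images of \<open>inf_word w\<close>, as \<open>final_word\<close>
  demands.\<close>

lemma period_imp_inf_word:
  assumes "(shift_add 1 ^^ (2 ^ r)) y = zero_word"
  shows "y = inf_word (map y [0..<2 ^ r])"
  using assms unfolding period_iff
  by (auto simp: inf_word_def fun_eq_iff periodic_mod)

lemma inf_word_reaches_zero:
  assumes "length w = 2 ^ n"
  shows "(shift_add 1 ^^ (2 ^ n)) (inf_word w) = zero_word"
  unfolding period_iff by (simp add: inf_word_def assms)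

lemma inf_word_replicate:
  assumes "k > 0" "u \<noteq> []"
  shows "inf_word (concat (replicate k u)) = inf_word u"
proof
  fix j
  have *: "i < k * length u \<Longrightarrow> concat (replicate k u) ! i = u ! (i mod length u)" for i k
  proof (induction k arbitrary: i)
    case (Suc k)
    show ?case
    proof (cases "i < length u")
      case True
      then show ?thesis by (simp add: nth_append)
    next
      case False
      then have "concat (replicate (Suc k) u) ! i = u ! ((i - length u) mod length u)"
        using Suc by (simp add: nth_append)
      then show ?thesis using False by (simp add: le_mod_geq)
    qed
  qed simp
  have len: "length (concat (replicate k u)) = k * length u"
    by (simp add: length_concat sum_list_replicate)
  have "j mod (k * length u) < k * length u"
    using assms by simp
  then show "inf_word (concat (replicate k u)) j = inf_word u j"
    by (simp only: inf_word_def len *) (simp add: mod_mod_cancel)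
qed

text \<open>Every proper divisor of \<open>2 ^ n\<close> divides \<open>2 ^ (n - 1)\<close>. So
  \<open>w\<close> is a proper power exactly if \<open>2 ^ (n - 1)\<close> is a period of
  \<open>inf_word w\<close>, which by \<open>period_iff\<close> means that
  \<open>2 ^ (n - 1)\<close> steps reach zero.\<close>

lemma nonperiodic_iff_arnold:
  assumes len: "length w = 2 ^ n" and "n > 0"
  shows "nonperiodic w \<longleftrightarrow> 2 ^ (n - 1) < arnold (inf_word w)"
proof -
  have two: "(2::nat) ^ n = 2 ^ (n - 1) + 2 ^ (n - 1)"
    using \<open>n > 0\<close> by (cases n) simp_all
  have "(\<exists>u k. k \<ge> 2 \<and> w = concat (replicate k u)) \<longleftrightarrow> arnold (inf_word w) \<le> 2 ^ (n - 1)"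
    (is "?L \<longleftrightarrow> ?R")
  proof
    assume ?L
    then obtain u k where k: "k \<ge> 2" and w: "w = concat (replicate k u)" by blast
    have kn: "k * length u = 2 ^ n"
      using len by (simp add: w length_concat sum_list_replicate)
    then obtain i where i: "i \<le> n" "length u = 2 ^ i"
      using divides_primepow_nat [of 2 "length u" n] two_is_prime_nat by (metis dvd_triv_right)
    have "i \<noteq> n" using kn k i by auto
    then have dvd: "length u dvd 2 ^ (n - 1)"
      using i by (auto intro!: le_imp_power_dvd)
    have "u \<noteq> []" using i by auto
    then have "inf_word w = inf_word u"
      using k by (simp add: w inf_word_replicate)
    moreover have "inf_word u (j + 2 ^ (n - 1)) = inf_word u j" for j
      using dvd by (auto simp: inf_word_def)
    ultimately show ?R
      unfolding arnold_le_iff [OF inf_word_reaches_zero [OF len]] period_iff by simp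
  next
    assume ?R
    then have per: "inf_word w (j + 2 ^ (n - 1)) = inf_word w j" for j
      by (simp only: arnold_le_iff [OF inf_word_reaches_zero [OF len]] period_iff)
    have "w ! j = w ! (j + 2 ^ (n - 1))" if "j < 2 ^ (n - 1)" for j
      using per [of j] that by (simp add: inf_word_def len two)
    then have "drop (2 ^ (n - 1)) w = take (2 ^ (n - 1)) w"
      by (intro nth_equalityI) (auto simp: len two add.commute)
    then have "w = concat (replicate 2 (take (2 ^ (n - 1)) w))"
      using append_take_drop_id [of "2 ^ (n - 1)" w] by (simp add: numeral_2_eq_2)
    then show ?L by blast
  qed
  then show ?thesis unfolding nonperiodic_def by auto
qed

text \<open>By Pascal's rule, binomial coefficients modulo 2 give words of every complexity.\<close>

lemma funpow_choose:
  "(shift_add 1 ^^ s) (\<lambda>j. of_nat (j choose (s + c))) = (\<lambda>j. of_nat (j choose c))"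
proof (induction s)
  case (Suc s)
  have "x + (y + x) = y" for x y :: bit
    by (cases x; cases y) simp_all
  then have "shift_add 1 (\<lambda>j. of_nat (j choose (Suc s + c))) = (\<lambda>j. of_nat (j choose (s + c)))"
    by (simp add: shift_add_def fun_eq_iff)
  then show ?case
    using Suc.IH by (simp only: funpow_Suc_right comp_apply)
qed simp

lemma exists_arnold_eq:
  assumes "0 < a" "a \<le> 2 ^ n"
  shows "\<exists>w. length w = 2 ^ n \<and> arnold (inf_word w) = a"
proof -
  let ?y = "\<lambda>j. of_nat (j choose (a - 1)) :: bit"
  \<comment> \<open>Lowering the index \<open>a - 1\<close> to 0 leaves the constant word 1, which
    is not yet zero; one more step makes it zero.\<close>
  have one: "(shift_add 1 ^^ (a - 1)) ?y = (\<lambda>_. 1)"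
    using funpow_choose [of "a - 1" 0] by simp
  have "(shift_add 1 ^^ Suc (a - 1)) ?y = zero_word"
    by (simp only: funpow.simps comp_apply one) (simp add: shift_add_def zero_word_def fun_eq_iff)
  then have zero: "(shift_add 1 ^^ a) ?y = zero_word"
    using assms by simp
  have "\<not> arnold ?y \<le> a - 1" and "arnold ?y \<le> a"
    unfolding arnold_le_iff [OF zero] one by (simp_all add: zero zero_word_def fun_eq_iff del: One_nat_def)
  then have a: "arnold ?y = a" by simp
  then have "arnold ?y \<le> 2 ^ n" using assms by simp
  then have "?y = inf_word (map ?y [0..<2 ^ n])"
    by (intro period_imp_inf_word) (simp only: arnold_le_iff [OF zero])
  then show ?thesis
    using a by (intro exI [of _ "map ?y [0..<2 ^ n]"]) simp
qed

section \<open>Sums of ranks and runs of binary ones\<close>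

text \<open>All operators are powers of the rank-1 operator, so they commute and only the sum of
  their ranks matters.\<close>

lemma fold_shift_add:
  "fold (\<lambda>r. shift_add (2 ^ r)) rs = shift_add 1 ^^ (\<Sum>r\<leftarrow>rs. 2 ^ r)"
proof (induction rs)
  case (Cons r rs)
  have "fold (\<lambda>r. shift_add (2 ^ r)) (r # rs)
      = (shift_add 1 ^^ (\<Sum>r\<leftarrow>rs. 2 ^ r)) \<circ> (shift_add 1 ^^ (2 ^ r))"
    unfolding shift_add_power by (simp only: fold.simps Cons.IH)
  then show ?case
    by (simp only: funpow_add [symmetric] list.map sum_list.Cons add.commute)
qed (simp add: id_def)

lemma sum_power2_atLeastLessThan:
  "m \<le> k \<Longrightarrow> (\<Sum>i = m..<k. 2 ^ i) + 2 ^ m = (2 ^ k :: nat)"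
  by (induction k rule: dec_induct) simp_all

text \<open>The runs are the fibres of the map \<open>g\<close> that sends a one to the nearest zero below it.\<close>

lemma long_run:
  fixes X :: "nat set"
  assumes "X \<subseteq> {1..<n}" "X \<noteq> {}"
  obtains m k where "1 \<le> m" "m < k" "{m..<k} \<subseteq> X"
    "card X \<le> card {m..<k} * (n - card X)"
proof -
  define Z where "Z = {..<n} - X"
  define g where "g i = Max {j \<in> Z. j < i}" for i
  have finX: "finite X" and n: "n > 0"
    using assms by (auto intro: finite_subset)
  have "X \<subseteq> {..<n}" using assms(1) by auto
  then have "card Z = n - card X"
    using finX by (simp add: Z_def card_Diff_subset)
  moreover have "finite Z" "0 \<in> Z"
    using assms(1) n by (auto simp: Z_def)
  ultimately have Z: "finite Z" "0 \<in> Z" "card Z = n - card X" by blast+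
  have gZ: "g i \<in> Z" "g i < i" "\<And>l. l \<in> Z \<Longrightarrow> l < i \<Longrightarrow> l \<le> g i" if "i \<in> X" for i
  proof -
    \<comment> \<open>As \<open>0 \<in> Z\<close>, the \<open>Max\<close> in \<open>g i\<close> is
      taken over a nonempty set.\<close>
    have "0 < i" using that assms by auto
    then have "finite {j \<in> Z. j < i}" "{j \<in> Z. j < i} \<noteq> {}" using Z by auto
    from Max_in [OF this] Max_ge [OF this(1)]
    show "g i \<in> Z" "g i < i" "\<And>l. l \<in> Z \<Longrightarrow> l < i \<Longrightarrow> l \<le> g i" by (auto simp: g_def)
  qed
  \<comment> \<open>By the pigeonhole principle, some fibre has at least the average size.\<close>
  have "\<exists>j\<in>Z. card X \<le> card (g -` {j} \<inter> X) * card Z"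
    using pigeonhole_card [of g X Z] gZ Z finX by auto
  then obtain j where j: "j \<in> Z" "card X \<le> card (g -` {j} \<inter> X) * card Z" by blast
  define B where "B = g -` {j} \<inter> X"
  have B: "finite B" "B \<noteq> {}"
    using j(2) finX assms(2) by (auto simp: B_def)
  define K where "K = Max B"
  have K: "K \<in> B" using B by (simp add: K_def)
  \<comment> \<open>Since \<open>g K = j\<close>, no element of \<open>Z\<close> lies above
    \<open>j\<close> and up to \<open>K\<close>, so the fibre has no gaps.\<close>
  have *: "i \<in> X \<and> g i = j" if "j < i" "i \<le> K" for i
  proof -
    have gK: "g K = j" "K \<in> X" using K by (auto simp: B_def)
    have no: "l \<notin> Z" if "j < l" "l \<le> K" for l
      using that gZ(3) [of K l] gK by (cases "l = K") (auto simp: Z_def)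
    have "i < n" using that gK assms by auto
    then have "i \<in> X" using no [OF that] by (simp add: Z_def)
    moreover have "g i = j"
      using gZ [OF \<open>i \<in> X\<close>] j(1) that no [of "g i"] by (metis le_antisym le_trans less_imp_le not_le)
    ultimately show ?thesis by simp
  qed
  have "B = {Suc j..<Suc K}"
  proof
    show "B \<subseteq> {Suc j..<Suc K}"
      using gZ(2) Max_ge [OF B(1)] by (auto simp: B_def K_def less_Suc_eq_le Suc_le_eq)
    show "{Suc j..<Suc K} \<subseteq> B" using * by (auto simp: B_def)
  qed
  moreover have "j < K" using K gZ(2) by (auto simp: B_def)
  moreover have "B \<subseteq> X" by (simp add: B_def)
  ultimately show thesis
    using j(2) Z(3) by (intro that [of "Suc j" "Suc K"]) (simp_all add: B_def)
qed

text \<open>Here \<open>p\<close> counts the ones, \<open>f\<close> is the length of a run and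
  \<open>p - f\<close> the number of operators left. With \<open>z = n - p\<close> zeros, the last
  hypothesis gives \<open>f \<ge> n / z - 1\<close>.\<close>

lemma run_bound:
  fixes p f n :: nat
  assumes "f \<le> p" "p < n" "p \<le> f * (n - p)"
  shows "int (p - f) \<le> \<lfloor>real n - 2 * sqrt (real n) + 1\<rfloor>"
proof -
  define z where "z = real (n - p)"
  have z: "z > 0" and p: "real p = real n - z"
    using assms by (auto simp: z_def)
  have "real p \<le> real f * z"
    using assms(3) unfolding z_def by (metis of_nat_le_iff of_nat_mult)
  then have f: "real n / z - 1 \<le> real f"
    using z by (simp add: p field_simps)
  \<comment> \<open>Expanding the square and dividing by \<open>z\<close> gives the inequality of
    arithmetic and geometric means for \<open>z\<close> and \<open>n / z\<close>.\<close>
  have "0 \<le> (z - sqrt n)\<^sup>2" by simp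
  then have "2 * sqrt n * z \<le> z * z + n"
    by (simp add: power2_diff) (simp add: power2_eq_square algebra_simps)
  then have "2 * sqrt n \<le> z + n / z"
    using z by (simp add: field_simps)
  then have "real (p - f) \<le> real n - 2 * sqrt n + 1"
    using f p assms(1) by (simp add: of_nat_diff)
  then show ?thesis by (subst le_floor_iff) simp
qed

text \<open>For a word of complexity \<open>a\<close>, \<open>x\<close> will be \<open>a - 1\<close>
  or \<open>a - 2\<close>. Evenness makes digit 0 a zero, so the run from \<open>long_run\<close>
  starts at \<open>m \<ge> 1\<close>, as a final complexity requires.\<close>

lemma split_off_run:
  fixes x :: nat
  assumes "even x" "0 < x" "x < 2 ^ n"
  obtains rs m k where "\<forall>r\<in>set rs. r \<le> n" "1 \<le> m" "m \<le> k - 1"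
    "x = (\<Sum>r\<leftarrow>rs. 2 ^ r) + (2 ^ k - 2 ^ m)"
    "int (length rs) \<le> \<lfloor>real n - 2 * sqrt (real n) + 1\<rfloor>"
proof -
  define X where "X = set_decode x"
  have x: "x = (\<Sum>i\<in>X. 2 ^ i)"
    using set_decode_inverse [of x] by (simp add: X_def set_encode_def)
  have finX: "finite X" by (simp add: X_def)
  have "i < n" if "i \<in> X" for i
  proof -
    have "2 ^ i \<le> x"
      unfolding x using finX that by (intro member_le_sum) auto
    with assms(3) have "(2::nat) ^ i < 2 ^ n" by linarith
    then show ?thesis by simp
  qed
  moreover have "0 \<notin> X" using assms(1) by (simp add: X_def set_decode_def)
  ultimately have X: "X \<subseteq> {1..<n}"
    by (metis One_nat_def Suc_leI atLeastLessThan_iff bot_nat_0.not_eq_extremum subsetI)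
  have "X \<noteq> {}" using x assms(2) by auto
  with X obtain m k where mk: "1 \<le> m" "m < k" "{m..<k} \<subseteq> X"
    "card X \<le> card {m..<k} * (n - card X)"
    by (rule long_run)
  \<comment> \<open>The ones outside the run become the exponents of the operators, each used
    once.\<close>
  define rs where "rs = sorted_list_of_set (X - {m..<k})"
  have rs: "set rs = X - {m..<k}" "distinct rs"
    using finX by (simp_all add: rs_def)
  have "(\<Sum>r\<leftarrow>rs. 2 ^ r) = (\<Sum>i\<in>X - {m..<k}. 2 ^ i :: nat)"
    using rs by (simp add: sum_list_distinct_conv_sum_set)
  moreover have "(\<Sum>i = m..<k. 2 ^ i) = (2 ^ k - 2 ^ m :: nat)"
    using sum_power2_atLeastLessThan [of m k] mk(2) by linarith
  ultimately have sum: "x = (\<Sum>r\<leftarrow>rs. 2 ^ r) + (2 ^ k - 2 ^ m)"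
    using sum.subset_diff [OF mk(3) finX, of "\<lambda>i. 2 ^ i :: nat"] x by simp
  have "card X \<le> card {1..<n}" using X by (intro card_mono) auto
  moreover have "n > 0" using X \<open>X \<noteq> {}\<close> by auto
  ultimately have "card X < n" by simp
  moreover have "card {m..<k} \<le> card X" using mk(3) finX by (rule card_mono [rotated])
  moreover have "length rs = card X - card {m..<k}"
    using rs mk(3) by (metis card_Diff_subset distinct_card finite_atLeastLessThan)
  ultimately have "int (length rs) \<le> \<lfloor>real n - 2 * sqrt (real n) + 1\<rfloor>"
    using run_bound mk(4) by metis
  moreover have "\<forall>r\<in>set rs. r \<le> n" using rs X by auto
  ultimately show thesis
    using mk sum by (intro that [of rs m k]) auto
qed

section \<open>Reaching a final word, and the Shannon function\<close>

text \<open>The operators in \<open>rs\<close> remove exactly the sum. They commute with the rank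
  \<open>2 ^ n\<close> operator, so the image still has period \<open>2 ^ n\<close>.\<close>

lemma transforms_to_final:
  assumes len: "length w = 2 ^ n" and "\<forall>r\<in>set rs. r \<le> n" and "1 \<le> m" "m \<le> k - 1"
    and "arnold (inf_word w) = (\<Sum>r\<leftarrow>rs. 2 ^ r) + (2 ^ k - 2 ^ m + 1)"
  shows "\<exists>v. final_word v \<and> transforms_by n (length rs) (inf_word w) v"
proof -
  let ?v = "(shift_add 1 ^^ (\<Sum>r\<leftarrow>rs. 2 ^ r)) (inf_word w)"
  note zero = inf_word_reaches_zero [OF len]
  have v: "arnold ?v = 2 ^ k - 2 ^ m + 1"
    using assms(5) by (simp add: arnold_funpow [OF zero] del: One_nat_def)
  have "(shift_add 1 ^^ (2 ^ n)) ?v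
      = (shift_add 1 ^^ (\<Sum>r\<leftarrow>rs. 2 ^ r)) ((shift_add 1 ^^ (2 ^ n)) (inf_word w))"
    by (simp only: funpow_add [THEN fun_cong, unfolded comp_apply, symmetric] add.commute)
  then have "?v = inf_word (map ?v [0..<2 ^ n])"
    by (intro period_imp_inf_word) (simp only: zero shift_add_one_zero_word)
  moreover have "length (map ?v [0..<2 ^ n]) = 2 ^ n" by simp
  moreover have "1 \<le> k" using assms(3,4) by simp
  ultimately have "final_word ?v"
    unfolding final_word_def using v assms(3,4) by blast
  moreover have "transforms_by n (length rs) (inf_word w) ?v"
    unfolding transforms_by_def using assms(2) by (intro exI [of _ rs]) (simp only: fold_shift_add)
  ultimately show ?thesis by blast
qed

text \<open>Existence stands next to the bound because the \<open>LEAST\<close> in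
  \<open>min_ops\<close> is meaningful only if some number of operators works.\<close>

lemma min_ops_bound:
  fixes w :: "bit list"
  assumes len: "length w = 2 ^ n" and "nonperiodic w" and "n \<ge> 2"
  shows "\<exists>t v. final_word v \<and> transforms_by n t (inf_word w) v" (is ?ex)
    and "int (min_ops n w) \<le>
           (if odd (arnold (inf_word w)) then \<lfloor>real n - 2 * sqrt (real n) + 1\<rfloor>
            else \<lfloor>real n - 2 * sqrt (real n) + 2\<rfloor>)" (is "_ \<le> ?b")
proof -
  define a where "a = arnold (inf_word w)"
  \<comment> \<open>This yields \<open>a > 2\<close>, so that \<open>a - 1\<close> and
    \<open>a - 2\<close> are both positive.\<close>
  have "(2::nat) ^ 1 \<le> 2 ^ (n - 1)" using assms(3) by (intro power_increasing) auto
  then have a: "2 < a" "a \<le> 2 ^ n"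
    using nonperiodic_iff_arnold [OF len] assms arnold_le_iff [of "2 ^ n" "inf_word w" "2 ^ n"]
      inf_word_reaches_zero [OF len] by (auto simp: a_def simp del: One_nat_def)
  have "\<exists>t v. int t \<le> ?b \<and> final_word v \<and> transforms_by n t (inf_word w) v"
  proof (cases "odd a")
    case True
    then have "even (a - 1)" "0 < a - 1" "a - 1 < 2 ^ n" using a by auto
    then obtain rs m k where *: "\<forall>r\<in>set rs. r \<le> n" "1 \<le> m" "m \<le> k - 1"
      "a - 1 = (\<Sum>r\<leftarrow>rs. 2 ^ r) + (2 ^ k - 2 ^ m)"
      "int (length rs) \<le> \<lfloor>real n - 2 * sqrt (real n) + 1\<rfloor>"
      by (rule split_off_run)
    have "arnold (inf_word w) = (\<Sum>r\<leftarrow>rs. 2 ^ r) + (2 ^ k - 2 ^ m + 1)"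
      using *(4) a unfolding a_def by linarith
    with * have "\<exists>v. final_word v \<and> transforms_by n (length rs) (inf_word w) v"
      by (intro transforms_to_final [OF len])
    moreover have "int (length rs) \<le> ?b"
      using *(5) True by (simp add: a_def)
    ultimately show ?thesis by blast
  next
    case False
    \<comment> \<open>One unit is the \<open>+ 1\<close> of the final complexity, the other is
      removed by the rank-1 operator.\<close>
    then have "even (a - 2)" "0 < a - 2" "a - 2 < 2 ^ n" using a by auto
    then obtain rs m k where *: "\<forall>r\<in>set rs. r \<le> n" "1 \<le> m" "m \<le> k - 1"
      "a - 2 = (\<Sum>r\<leftarrow>rs. 2 ^ r) + (2 ^ k - 2 ^ m)"
      "int (length rs) \<le> \<lfloor>real n - 2 * sqrt (real n) + 1\<rfloor>"
      by (rule split_off_run)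
    \<comment> \<open>Exponent 0 is the rank-1 operator; it accounts for the difference of 1 between
      the two bounds.\<close>
    have "\<forall>r\<in>set (0 # rs). r \<le> n" using *(1) by simp
    moreover have "arnold (inf_word w) = (\<Sum>r\<leftarrow>0 # rs. 2 ^ r) + (2 ^ k - 2 ^ m + 1)"
      unfolding list.map sum_list.Cons power_0 using *(4) a unfolding a_def by linarith
    ultimately have "\<exists>v. final_word v \<and> transforms_by n (length (0 # rs)) (inf_word w) v"
      using *(2,3) by (intro transforms_to_final [OF len])
    moreover have "int (length (0 # rs)) \<le> ?b"
      using *(5) False by (simp add: a_def)
    ultimately show ?thesis by blast
  qed
  then obtain t v where t: "int t \<le> ?b" "final_word v" "transforms_by n t (inf_word w) v"
    by blast
  from t show ?ex by blast
  have "min_ops n w \<le> t"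
    unfolding min_ops_def using t by (intro Least_le) blast
  with t(1) show "int (min_ops n w) \<le> ?b" by linarith
qed

text \<open>\<open>Max {}\<close> is unspecified, so a word of the given parity has to exist.\<close>

lemma Sh_le:
  assumes "\<exists>w. length w = 2 ^ n \<and> nonperiodic w \<and> P (arnold (inf_word w))"
    and "\<And>w. length w = 2 ^ n \<Longrightarrow> nonperiodic w \<Longrightarrow> P (arnold (inf_word w)) \<Longrightarrow> int (min_ops n w) \<le> b"
  shows "int (Sh P n) \<le> b"
proof -
  let ?M = "{min_ops n w | w. length w = 2 ^ n \<and> nonperiodic w \<and> P (arnold (inf_word w))}"
  have "?M \<subseteq> {..nat b}" using assms(2) by fastforce
  then have "finite ?M" by (rule finite_subset) simp
  moreover have "?M \<noteq> {}" using assms(1) by blast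
  ultimately have "Sh P n \<in> ?M" unfolding Sh_def by (rule Max_in)
  then show ?thesis using assms(2) by auto
qed

theorem theorem2p1:
  fixes n :: nat
  assumes "n \<ge> 5"
  shows "int (Sh odd n) \<le> \<lfloor>real n - 2 * sqrt (real n) + 1\<rfloor>
       \<and> int (Sh even n) \<le> \<lfloor>real n - 2 * sqrt (real n) + 2\<rfloor>
       \<and> (\<forall>w :: bit list. length w = 2 ^ n \<and> nonperiodic w \<longrightarrow>
            (\<exists>t v. final_word v \<and> transforms_by n t (inf_word w) v)
          \<and> int (min_ops n w) \<le>
              (if odd (arnold (inf_word w)) then \<lfloor>real n - 2 * sqrt (real n) + 1\<rfloor>
               else \<lfloor>real n - 2 * sqrt (real n) + 2\<rfloor>))"
proof -
  have n: "n \<ge> 2" "n > 0" using assms by auto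
  have "(2::nat) ^ 1 \<le> 2 ^ (n - 1)" using n by (intro power_increasing) auto
  moreover have "(2::nat) ^ n = 2 * 2 ^ (n - 1)" using n by (cases n) simp_all
  \<comment> \<open>The complexities \<open>2 ^ n - 1\<close> and \<open>2 ^ n\<close> serve as odd
    and even examples; both exceed \<open>2 ^ (n - 1)\<close>, so their words are
    nonperiodic.\<close>
  ultimately have pow: "2 ^ (n - 1) < (2::nat) ^ n - 1" "even ((2::nat) ^ n)" "odd ((2::nat) ^ n - 1)"
    by auto
  have ex: "\<exists>w. length w = 2 ^ n \<and> nonperiodic w \<and> P (arnold (inf_word w))"
    if "2 ^ (n - 1) < a" "a \<le> 2 ^ n" "P a" for P a
    using exists_arnold_eq [of a n] that nonperiodic_iff_arnold [OF _ n(2)] by auto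
  have "int (Sh odd n) \<le> \<lfloor>real n - 2 * sqrt (real n) + 1\<rfloor>"
  proof (rule Sh_le)
    show "\<exists>w. length w = 2 ^ n \<and> nonperiodic w \<and> odd (arnold (inf_word w))"
      using ex [of "2 ^ n - 1" odd] pow by simp
  qed (use min_ops_bound(2) n in fastforce)
  moreover have "int (Sh even n) \<le> \<lfloor>real n - 2 * sqrt (real n) + 2\<rfloor>"
  proof (rule Sh_le)
    show "\<exists>w. length w = 2 ^ n \<and> nonperiodic w \<and> even (arnold (inf_word w))"
      using ex [of "2 ^ n" even] pow by simp
  qed (use min_ops_bound(2) n in fastforce)
  ultimately show ?thesis
    using min_ops_bound n by blast
qed

end
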